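(* Let $T$ be a nontrivial tree. Then $\gamma_t(T)\leq 2\gamma_{t2}(T)-1$. Moreover, $\gamma_t(T)=2\gamma_{t2}(T)-1$ if and only if there is a labeling $S'$ of $T$ such that $(T,S')\in\mathscr{T}_1$.
   Context: $\gamma_t(G)$ is the total domination number (minimum size of a set $D$ such that every vertex of $G$ has a neighbor in $D$). A semitotal dominating set of a graph without isolated vertices is a dominating set $S$ in which every vertex of $S$ is at distance at most $2$ from another vertex of $S$; $\gamma_{t2}(G)$ is the minimum size of such a set. A labeling of a tree assigns to each vertex a status in $\{A,B,C,D\}$. The family $\mathscr{T}_1$ of labeled trees is the smallest family that contains the path $P_5=x_1x_2x_3x_4x_5$ labeled with statuses $C,B,D,A,C$ respectively, and is closed under the following operations applied to a labeled tree in $\mathscr{T}_1$ and a vertex $v$ of it (old statuses unchanged): $\mathscr{O}_1$: if $v$ has status $A$ or $B$, add a new vertex $u$ and the edge $uv$, with $u$ of status $C$. $\mathscr{O}_3$: if $v$ has status $A$, add a new path $u_1u_2u_3$ and the edge $u_1v$, with $u_1,u_2,u_3$ of statuses $D,B,C$ respectively. *)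

theory Defs
  imports "Graph_Theory.Graph_Theory"
begin

text \<open>
  A finite simple graph is a \<^locale>\<open>pair_graph\<close>: each undirected edge is represented by
  its two opposite arcs. In this representation \<open>a, b, a\<close> is a cycle for the library, so the library's
  \<^const>\<open>tree\<close> would exclude every graph with an edge. The cycles of the undirected graph
  are the library cycles of length at least 3.
\<close>

definition is_tree :: "'a pair_pre_digraph \<Rightarrow> bool" where
  "is_tree G \<longleftrightarrow> pair_graph G \<and> Digraph_Component.connected (with_proj G) \<and>
     \<not> (\<exists>p. pre_digraph.cycle (with_proj G) p \<and> 3 \<le> length p)"

definition distance :: "'a pair_pre_digraph \<Rightarrow> 'a \<Rightarrow> 'a \<Rightarrow> ereal" where
  "distance G u v = wf_digraph.\<mu> (with_proj G) (\<lambda>_. 1) u v"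

definition dominating :: "'a pair_pre_digraph \<Rightarrow> 'a set \<Rightarrow> bool" where
  "dominating G X \<longleftrightarrow> X \<subseteq> pverts G \<and> (\<forall>v \<in> pverts G - X. \<exists>u \<in> X. (v, u) \<in> parcs G)"

definition total_dominating :: "'a pair_pre_digraph \<Rightarrow> 'a set \<Rightarrow> bool" where
  "total_dominating G X \<longleftrightarrow> X \<subseteq> pverts G \<and> (\<forall>v \<in> pverts G. \<exists>u \<in> X. (v, u) \<in> parcs G)"

definition semitotal_dominating :: "'a pair_pre_digraph \<Rightarrow> 'a set \<Rightarrow> bool" where
  "semitotal_dominating G X \<longleftrightarrow>
     dominating G X \<and> (\<forall>u \<in> X. \<exists>w \<in> X. w \<noteq> u \<and> distance G u w \<le> 2)"

text \<open>
  Both numbers are meaningful for finite graphs without isolated vertices,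
  where the full vertex set is an admissible choice.
\<close>

definition total_domination_number :: "'a pair_pre_digraph \<Rightarrow> nat" where
  "total_domination_number G = (LEAST k. \<exists>X. total_dominating G X \<and> card X = k)"

definition semitotal_domination_number :: "'a pair_pre_digraph \<Rightarrow> nat" where
  "semitotal_domination_number G = (LEAST k. \<exists>X. semitotal_dominating G X \<and> card X = k)"

datatype status = StA | StB | StC | StD

definition labeling :: "'a pair_pre_digraph \<Rightarrow> ('a \<rightharpoonup> status) \<Rightarrow> bool" where
  "labeling G S \<longleftrightarrow> dom S = pverts G"

definition edges :: "('a \<times> 'a) set \<Rightarrow> ('a \<times> 'a) set" where
  "edges E = E \<union> E\<inverse>"

inductive_set family_T1 :: "('a pair_pre_digraph \<times> ('a \<rightharpoonup> status)) set" where
  P5: "distinct [x1, x2, x3, x4, x5] \<Longrightarrow>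
    (\<lparr> pverts = {x1, x2, x3, x4, x5},
       parcs = edges {(x1, x2), (x2, x3), (x3, x4), (x4, x5)} \<rparr>,
     [x1 \<mapsto> StC, x2 \<mapsto> StB, x3 \<mapsto> StD, x4 \<mapsto> StA, x5 \<mapsto> StC]) \<in> family_T1"
| O1: "(G, S) \<in> family_T1 \<Longrightarrow> v \<in> pverts G \<Longrightarrow> S v = Some StA \<or> S v = Some StB \<Longrightarrow>
    u \<notin> pverts G \<Longrightarrow>
    (\<lparr> pverts = pverts G \<union> {u}, parcs = parcs G \<union> edges {(u, v)} \<rparr>,
     S(u \<mapsto> StC)) \<in> family_T1"
| O3: "(G, S) \<in> family_T1 \<Longrightarrow> v \<in> pverts G \<Longrightarrow> S v = Some StA \<Longrightarrow>
    distinct [u1, u2, u3] \<Longrightarrow> {u1, u2, u3} \<inter> pverts G = {} \<Longrightarrow>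
    (\<lparr> pverts = pverts G \<union> {u1, u2, u3},
       parcs = parcs G \<union> edges {(u1, u2), (u2, u3), (u1, v)} \<rparr>,
     S(u1 \<mapsto> StD, u2 \<mapsto> StB, u3 \<mapsto> StC)) \<in> family_T1"

end

theory Submission
  imports Defs
begin

text \<open>
  Let \<open>X\<close> be a minimum semitotal dominating set. Giving each member of \<open>X\<close> a neighbour produces a
  total dominating set, and two members of \<open>X\<close> at distance at most 2 can share the added neighbour
  (or need none), which gives the bound. If the bound is attained, nothing more can be saved: \<open>X\<close> is
  independent, no three members have a common neighbour, and there are no two disjoint pairs at
  distance 2. Hence some \<open>a \<in> X\<close> has a common neighbour \<open>d b\<close> with every other \<open>b \<in> X\<close>, where \<open>d\<close> is
  injective. The edges of these paths, with one edge to \<open>X\<close> for each remaining vertex, form a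
  connected spanning subgraph, so they are all the edges of the tree. Every member of \<open>X\<close> must carry
  a leaf, since otherwise it could be dropped. These spiders are exactly the members of the family.
\<close>

section \<open>The family as a class of spiders\<close>

text \<open>
  The centre \<open>a\<close> has status A, the members of \<open>B\<close> have status B, \<open>d b\<close> is the vertex of status D
  between \<open>b\<close> and \<open>a\<close>, and the leaves \<open>l \<in> L\<close>, of status C, hang at \<open>p l\<close>.
\<close>
definition spider_graph :: "'a \<Rightarrow> 'a set \<Rightarrow> ('a \<Rightarrow> 'a) \<Rightarrow> 'a set \<Rightarrow> ('a \<Rightarrow> 'a) \<Rightarrow> 'a pair_pre_digraph" where
  "spider_graph a B d L p =
     \<lparr> pverts = insert a B \<union> d ` B \<union> L,
       parcs = edges ((\<Union>b\<in>B. {(b, d b), (d b, a)}) \<union> (\<Union>l\<in>L. {(l, p l)})) \<rparr>"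

text \<open>The condition on the image of \<open>L\<close> under \<open>p\<close> says at once that
  leaves hang only at \<open>a\<close> and at members of \<open>B\<close>, and that each of these
  vertices carries a leaf. As \<open>B\<close> is nonempty, the smallest case is the path on five
  vertices.\<close>

definition spider :: "'a \<Rightarrow> 'a set \<Rightarrow> ('a \<Rightarrow> 'a) \<Rightarrow> 'a set \<Rightarrow> ('a \<Rightarrow> 'a) \<Rightarrow> bool" where
  "spider a B d L p \<longleftrightarrow> finite B \<and> B \<noteq> {} \<and> a \<notin> B \<and> inj_on d B \<and> d ` B \<inter> insert a B = {} \<and>
     finite L \<and> L \<inter> (insert a B \<union> d ` B) = {} \<and> p ` L = insert a B"

lemma parcs_spider_graph_iff:
  "(x, y) \<in> parcs (spider_graph a B d L p) \<longleftrightarrow>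
     x \<in> B \<and> y = d x \<or> y \<in> B \<and> x = d y \<or> x \<in> d ` B \<and> y = a \<or> y \<in> d ` B \<and> x = a \<or>
     x \<in> L \<and> y = p x \<or> y \<in> L \<and> x = p y"
  by (auto simp: spider_graph_def edges_def)

text \<open>Statuses decide where the operations may attach, so the induction also tracks which
  vertices have status A or B. Then \<open>O1\<close> can only add a leaf at \<open>a\<close> or in
  \<open>B\<close>, and \<open>O3\<close> can only add a leg at \<open>a\<close>.\<close>

lemma family_T1_imp_spider:
  assumes "(G, S) \<in> family_T1"
  shows "\<exists>a B d L p. spider a B d L p \<and> G = spider_graph a B d L p \<and>
    (\<forall>v. S v = Some StA \<longleftrightarrow> v = a) \<and> (\<forall>v. S v = Some StB \<longleftrightarrow> v \<in> B)"
  using assms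
proof (induction rule: family_T1.induct)
  case (P5 x1 x2 x3 x4 x5)
  let ?p = "\<lambda>l. if l = x1 then x2 else x4"
  have "spider x4 {x2} (\<lambda>_. x3) {x1, x5} ?p"
    using P5 by (auto simp: spider_def)
  moreover have "\<lparr> pverts = {x1, x2, x3, x4, x5},
       parcs = edges {(x1, x2), (x2, x3), (x3, x4), (x4, x5)} \<rparr> = spider_graph x4 {x2} (\<lambda>_. x3) {x1, x5} ?p"
    using P5 by (auto simp: spider_graph_def edges_def)
  moreover have "\<forall>v. [x1 \<mapsto> StC, x2 \<mapsto> StB, x3 \<mapsto> StD, x4 \<mapsto> StA, x5 \<mapsto> StC] v = Some StA \<longleftrightarrow> v = x4"
      "\<forall>v. [x1 \<mapsto> StC, x2 \<mapsto> StB, x3 \<mapsto> StD, x4 \<mapsto> StA, x5 \<mapsto> StC] v = Some StB \<longleftrightarrow> v \<in> {x2}"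
    using P5 by auto
  ultimately show ?case by blast
next
  case (O1 G S v u)
  then obtain a B d L p where sp: "spider a B d L p" and G: "G = spider_graph a B d L p"
    and S: "\<forall>v. S v = Some StA \<longleftrightarrow> v = a" "\<forall>v. S v = Some StB \<longleftrightarrow> v \<in> B"
    by blast
  let ?p = "p(u := v)"
  have u: "u \<notin> insert a B \<union> d ` B \<union> L" using O1 G by (auto simp: spider_graph_def)
  have v: "v \<in> insert a B" using O1 S by auto
  have im: "?p ` L = p ` L" using u by (intro image_cong) auto
  have "spider a B d (insert u L) ?p"
    using sp u v im by (auto simp: spider_def simp del: fun_upd_apply) (auto simp: spider_def)
  moreover have "(\<Union>l\<in>insert u L. {(l, ?p l)}) = insert (u, v) (\<Union>l\<in>L. {(l, p l)})"
    using u by auto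
  then have "\<lparr> pverts = pverts G \<union> {u}, parcs = parcs G \<union> edges {(u, v)} \<rparr> =
      spider_graph a B d (insert u L) ?p"
    unfolding G spider_graph_def edges_def by auto
  moreover have "\<forall>v. (S(u \<mapsto> StC)) v = Some StA \<longleftrightarrow> v = a" "\<forall>v. (S(u \<mapsto> StC)) v = Some StB \<longleftrightarrow> v \<in> B"
    using S u by auto
  ultimately show ?case by blast
next
  case (O3 G S v u1 u2 u3)
  then obtain a B d L p where sp: "spider a B d L p" and G: "G = spider_graph a B d L p"
    and S: "\<forall>v. S v = Some StA \<longleftrightarrow> v = a" "\<forall>v. S v = Some StB \<longleftrightarrow> v \<in> B"
    by blast
  let ?p = "p(u3 := u2)" and ?d = "d(u2 := u1)"
  have u: "u1 \<notin> insert a B \<union> d ` B \<union> L" "u2 \<notin> insert a B \<union> d ` B \<union> L"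
      "u3 \<notin> insert a B \<union> d ` B \<union> L" "distinct [u1, u2, u3]"
    using O3 G by (auto simp: spider_graph_def)
  have v: "v = a" using O3 S by auto
  have imp: "?p ` L = p ` L" and imd: "?d ` B = d ` B" using u by (auto intro!: image_cong)
  have "inj_on ?d B" using u sp by (intro inj_on_fun_updI) (auto simp: spider_def)
  then have "inj_on ?d (insert u2 B)" using u imd by auto
  moreover have "?p ` insert u3 L = insert u2 (p ` L)" "?d ` insert u2 B = insert u1 (d ` B)"
    using imp imd by auto
  ultimately have spider: "spider a (insert u2 B) ?d (insert u3 L) ?p"
    using sp u unfolding spider_def by auto
  \<comment> \<open>As \<open>u2\<close> and \<open>u3\<close> are new, the updates change neither
    \<open>d\<close> on \<open>B\<close> nor \<open>p\<close> on \<open>L\<close>, so both unions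
    only gain arcs of the new leg.\<close>
  have eqs: "(\<Union>l\<in>insert u3 L. {(l, ?p l)}) = {(u3, u2)} \<union> (\<Union>l\<in>L. {(l, p l)})"
      "(\<Union>b\<in>insert u2 B. {(b, ?d b), (?d b, a)}) =
        {(u2, u1), (u1, a)} \<union> (\<Union>b\<in>B. {(b, d b), (d b, a)})"
      "?d ` insert u2 B = insert u1 (d ` B)"
  proof -
    have "(\<Union>l\<in>L. {(l, ?p l)}) = (\<Union>l\<in>L. {(l, p l)})"
      using u by (intro SUP_cong) auto
    then show "(\<Union>l\<in>insert u3 L. {(l, ?p l)}) = {(u3, u2)} \<union> (\<Union>l\<in>L. {(l, p l)})"
      by (simp only: UN_insert fun_upd_same)
    have "(\<Union>b\<in>B. {(b, ?d b), (?d b, a)}) = (\<Union>b\<in>B. {(b, d b), (d b, a)})"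
      using u by (intro SUP_cong) auto
    then show "(\<Union>b\<in>insert u2 B. {(b, ?d b), (?d b, a)}) =
        {(u2, u1), (u1, a)} \<union> (\<Union>b\<in>B. {(b, d b), (d b, a)})"
      by (simp only: UN_insert fun_upd_same)
    show "?d ` insert u2 B = insert u1 (d ` B)"
      using imd by (simp only: image_insert fun_upd_same)
  qed
  have "\<lparr> pverts = pverts G \<union> {u1, u2, u3}, parcs = parcs G \<union> edges {(u1, u2), (u2, u3), (u1, v)} \<rparr> =
      spider_graph a (insert u2 B) ?d (insert u3 L) ?p"
    unfolding G v spider_graph_def eqs edges_def by auto
  moreover have "\<forall>v. (S(u1 \<mapsto> StD, u2 \<mapsto> StB, u3 \<mapsto> StC)) v = Some StA \<longleftrightarrow> v = a"
      "\<forall>v. (S(u1 \<mapsto> StD, u2 \<mapsto> StB, u3 \<mapsto> StC)) v = Some StB \<longleftrightarrow> v \<in> insert u2 B"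
    using S u by auto
  ultimately show ?case using spider by blast
qed

text \<open>A spider is built from one leg and two leaves (\<open>P5\<close>), then leg by leg with
  one leaf each (\<open>O3\<close>), then by the remaining leaves (\<open>O1\<close>).\<close>

lemma spider_imp_family_T1:
  assumes sp: "spider a B d L p"
  shows "\<exists>S. labeling (spider_graph a B d L p) S \<and> (spider_graph a B d L p, S) \<in> family_T1"
proof -
  \<comment> \<open>The labeling of the finished spider, fixed in advance: every stage carries its
    restriction to the vertices present, since old statuses never change.\<close>
  define f where "f = (\<lambda>v. Some (if v = a then StA else if v \<in> B then StB
    else if v \<in> d ` B then StD else StC))"
  have a: "a \<notin> B" and d: "inj_on d B" "d ` B \<inter> insert a B = {}" and L: "L \<inter> (insert a B \<union> d ` B) = {}"
    and p: "p ` L = insert a B" and fin: "finite B" "finite L" and ne: "B \<noteq> {}"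
    using sp by (auto simp: spider_def)
  have "\<forall>x\<in>insert a B. \<exists>l\<in>L. p l = x" using p by (metis imageE)
  \<comment> \<open>\<open>P5\<close> and \<open>O3\<close> supply one leaf with each vertex of
    status A or B; \<open>c\<close> chooses which one.\<close>
  then obtain c where c: "\<And>x. x \<in> insert a B \<Longrightarrow> c x \<in> L" "\<And>x. x \<in> insert a B \<Longrightarrow> p (c x) = x"
    by metis
  have injc: "inj_on c (insert a B)" by (rule inj_on_inverseI[of _ p]) (rule c(2))
  have fA: "f a = Some StA" and fB: "\<And>b. b \<in> B \<Longrightarrow> f b = Some StB"
    and fD: "\<And>b. b \<in> B \<Longrightarrow> f (d b) = Some StD" and fC: "\<And>l. l \<in> L \<Longrightarrow> f l = Some StC"
    using a d L by (auto simp: f_def)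
  define mem where "mem G \<longleftrightarrow> (G, f |` pverts G) \<in> family_T1" for G
  have legs: "mem (spider_graph a B' d (c ` insert a B') p)" if "finite B'" "B' \<noteq> {}" "B' \<subseteq> B" for B'
    using that
  proof (induction rule: finite_ne_induct)
    case (singleton b)
    then have b: "b \<in> B" by auto
    have dist: "distinct [c b, b, d b, a, c a]"
    proof -
      have "c a \<noteq> c b" using a b inj_onD[OF injc, of a b] by blast
      moreover have "d b \<notin> insert a B \<union> L" using b d(2) L by blast
      moreover have "c a \<in> L" "c b \<in> L" using b c(1) by auto
      moreover have "L \<inter> insert a B = {}" using L by blast
      ultimately show ?thesis using a b by auto
    qed
    have "f |` {c b, b, d b, a, c a} =
        [c b \<mapsto> StC, b \<mapsto> StB, d b \<mapsto> StD, a \<mapsto> StA, c a \<mapsto> StC]"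
      using dist fA fB[OF b] fD[OF b] fC[OF c(1)[of a]] fC[OF c(1)[of b]] b
      by (auto simp: restrict_map_def fun_eq_iff)
    moreover have "spider_graph a {b} d (c ` insert a {b}) p = \<lparr> pverts = {c b, b, d b, a, c a},
       parcs = edges {(c b, b), (b, d b), (d b, a), (a, c a)} \<rparr>"
    proof -
      have "p (c a) = a" "p (c b) = b" using c(2) b by auto
      then show ?thesis by (simp add: spider_graph_def edges_def) blast
    qed
    ultimately show ?case
      using family_T1.P5[OF dist] by (simp add: mem_def)
  next
    case (insert b F)
    then have b: "b \<in> B" "b \<notin> F" and F: "F \<subseteq> B" by auto
    let ?G = "spider_graph a F d (c ` insert a F) p"
    have cF: "c ` insert a F \<subseteq> L" using c F by auto
    have "c b \<notin> c ` insert a F"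
      using inj_on_image_mem_iff[OF injc, of b "insert a F"] b F a by blast
    have "d b \<notin> d ` F"
      using inj_on_image_mem_iff[OF d(1) b(1) F] b(2) by blast
    \<comment> \<open>Across the layers \<open>insert a B\<close>, image of \<open>d\<close> and
      \<open>L\<close>, freshness comes from disjointness; within a layer, from
      \<open>b \<notin> F\<close> and the injectivity of \<open>d\<close> and
      \<open>c\<close>.\<close>
    have new: "{d b, b, c b} \<inter> pverts ?G = {}"
    proof -
      have G: "pverts ?G = insert a F \<union> d ` F \<union> c ` insert a F" by (simp add: spider_graph_def)
      have dF: "d ` F \<subseteq> d ` B" and cb: "c b \<in> L" using F b c(1) by auto
      have db: "d b \<notin> insert a B \<union> L" using b d(2) L by blast
      have "d b \<notin> pverts ?G"
        unfolding G using db subsetD[OF F] subsetD[OF cF] \<open>d b \<notin> d ` F\<close>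
        by (simp only: Un_iff insert_iff) metis
      moreover have "b \<notin> insert a F" "b \<notin> d ` B" "b \<notin> L" using b a d(2) L by blast+
      then have "b \<notin> pverts ?G" unfolding G using subsetD[OF dF] subsetD[OF cF] by (simp only: Un_iff) metis
      moreover have "c b \<notin> insert a B" "c b \<notin> d ` B" using cb L by blast+
      then have "c b \<notin> pverts ?G"
        unfolding G using subsetD[OF F] subsetD[OF dF] \<open>c b \<notin> c ` insert a F\<close>
        by (simp only: Un_iff insert_iff) metis
      ultimately show ?thesis by blast
    qed
    have dist: "distinct [d b, b, c b]"
    proof -
      have "d b \<notin> insert a B \<union> L" using b d(2) L by blast
      moreover have "c b \<in> L" using b c(1) by auto
      moreover have "L \<inter> B = {}" using L by blast
      ultimately show ?thesis using b by auto
    qed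
    have mem: "(?G, f |` pverts ?G) \<in> family_T1" using insert by (auto simp: mem_def)
    have aG: "a \<in> pverts ?G" by (auto simp: spider_graph_def)
    have "(\<lparr> pverts = pverts ?G \<union> {d b, b, c b},
       parcs = parcs ?G \<union> edges {(d b, b), (b, c b), (d b, a)} \<rparr>,
       (f |` pverts ?G)(d b \<mapsto> StD, b \<mapsto> StB, c b \<mapsto> StC)) \<in> family_T1"
      using family_T1.O3[OF mem aG _ dist new] fA aG by simp
    moreover have "(f |` pverts ?G)(d b \<mapsto> StD, b \<mapsto> StB, c b \<mapsto> StC) = f |` (pverts ?G \<union> {d b, b, c b})"
      using fB[OF b(1)] fD[OF b(1)] fC[OF c(1)[of b]] b by (auto simp: restrict_map_def fun_eq_iff)
    moreover have "\<lparr> pverts = pverts ?G \<union> {d b, b, c b},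
       parcs = parcs ?G \<union> edges {(d b, b), (b, c b), (d b, a)} \<rparr> =
       spider_graph a (insert b F) d (c ` insert a (insert b F)) p"
    proof -
      have "p (c b) = b" using c(2) b by auto
      then show ?thesis by (simp add: spider_graph_def edges_def) blast
    qed
    ultimately show ?case unfolding mem_def by (metis pair_pre_digraph.select_convs(1))
  qed
  have "mem (spider_graph a B d (c ` insert a B \<union> M) p)" if "finite M" "M \<subseteq> L" for M
    using that
  proof (induction rule: finite_induct)
    case empty
    then show ?case using legs[OF fin(1) ne] by simp
  next
    case (insert u M)
    let ?L = "c ` insert a B \<union> M"
    let ?G = "spider_graph a B d ?L p"
    have mem: "(?G, f |` pverts ?G) \<in> family_T1" using insert by (auto simp: mem_def)
    \<comment> \<open>A leaf chosen by \<open>c\<close> is already present and leaves the graph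
      unchanged; any other one is added by \<open>O1\<close>.\<close>
    show ?case
    proof (cases "u \<in> ?L")
      case True
      then show ?thesis using mem by (simp add: mem_def insert_absorb)
    next
      case False
      have u: "u \<notin> pverts ?G" using False insert L by (auto simp: spider_graph_def)
      have pu: "p u \<in> insert a B" "p u \<in> pverts ?G" using p insert by (auto simp: spider_graph_def)
      have "(f |` pverts ?G) (p u) = Some StA \<or> (f |` pverts ?G) (p u) = Some StB"
        using pu fA fB by (auto simp: restrict_map_def)
      from family_T1.O1[OF mem pu(2) this u]
      have "(\<lparr> pverts = pverts ?G \<union> {u}, parcs = parcs ?G \<union> edges {(u, p u)} \<rparr>,
         (f |` pverts ?G)(u \<mapsto> StC)) \<in> family_T1" .
      moreover have "(f |` pverts ?G)(u \<mapsto> StC) = f |` (pverts ?G \<union> {u})"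
        using fC[of u] insert by (auto simp: restrict_map_def fun_eq_iff)
      moreover have "\<lparr> pverts = pverts ?G \<union> {u}, parcs = parcs ?G \<union> edges {(u, p u)} \<rparr> =
         spider_graph a B d (c ` insert a B \<union> insert u M) p"
        by (auto simp: spider_graph_def edges_def)
      ultimately show ?thesis unfolding mem_def by (metis pair_pre_digraph.select_convs(1))
    qed
  qed
  moreover have "c ` insert a B \<union> L = L" using c(1) by blast
  ultimately have "mem (spider_graph a B d L p)" using fin(2) by (metis subset_refl)
  moreover have "labeling G (f |` pverts G)" for G
    by (auto simp: labeling_def f_def)
  ultimately show ?thesis unfolding mem_def by blast
qed

section \<open>Distances and spanning subgraphs of trees\<close>

lemma distance_le_2_iff:
  assumes "pair_wf_digraph G" "u \<in> pverts G" "u \<noteq> w"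
  shows "distance G u w \<le> 2 \<longleftrightarrow> (u, w) \<in> parcs G \<or> (\<exists>z. (u, z) \<in> parcs G \<and> (z, w) \<in> parcs G)"
proof -
  interpret pair_wf_digraph G by fact
  have cost: "awalk_cost (\<lambda>_. 1) q = real (length q)" for q :: "('a \<times> 'a) list"
    by (induction q) (auto simp: awalk_cost_def)
  show ?thesis
  proof
    assume "distance G u w \<le> 2"
    \<comment> \<open>A strict bound on the infimum yields an actual walk of cost below 3; unit
      costs are lengths, hence integers, so nothing is lost.\<close>
    also have "(2::ereal) < 3" by simp
    finally have "(INF q\<in>{q. awalk u q w}. ereal (awalk_cost (\<lambda>_. 1) q)) < 3"
      by (simp add: distance_def \<mu>_def)
    then obtain q where q: "awalk u q w" "ereal (awalk_cost (\<lambda>_. 1) q) < 3"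
      by (auto simp: INF_less_iff)
    from q(2) have "real (length q) < 3" by (simp add: cost)
    then have "length q = 0 \<or> length q = 1 \<or> length q = 2" by linarith
    then show "(u, w) \<in> parcs G \<or> (\<exists>z. (u, z) \<in> parcs G \<and> (z, w) \<in> parcs G)"
      using q(1) \<open>u \<noteq> w\<close>
      by (auto simp: awalk_def length_Suc_conv numeral_2_eq_2)
  next
    assume "(u, w) \<in> parcs G \<or> (\<exists>z. (u, z) \<in> parcs G \<and> (z, w) \<in> parcs G)"
    then obtain q where "awalk u q w" "length q \<le> 2"
    proof (elim disjE exE)
      assume "(u, w) \<in> parcs G"
      then show ?thesis using assms(2) by (intro that[of "[(u, w)]"]) (auto simp: awalk_def)
    next
      fix z assume "(u, z) \<in> parcs G \<and> (z, w) \<in> parcs G"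
      then show ?thesis using assms(2) by (intro that[of "[(u, z), (z, w)]"]) (auto simp: awalk_def)
    qed
    then have "\<mu> (\<lambda>_. 1) u w \<le> ereal (real (length q))" "ereal (real (length q)) \<le> 2"
      using min_cost_le_walk_cost[of u q w "\<lambda>_. 1"] by (auto simp: cost)
    then show "distance G u w \<le> 2" unfolding distance_def by (rule order_trans)
  qed
qed

lemma is_tree_no_isolated:
  assumes "is_tree T" "2 \<le> card (pverts T)" "v \<in> pverts T"
  shows "\<exists>u. (v, u) \<in> parcs T"
proof -
  interpret pair_graph T using assms by (simp add: is_tree_def)
  have "pverts T \<noteq> {v}" using assms(2) by auto
  then obtain w where w: "w \<in> pverts T" "w \<noteq> v" using assms(3) by blast
  then have "v \<rightarrow>\<^sup>*\<^bsub>mk_symmetric T\<^esub> w"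
    using assms by (auto simp: is_tree_def connected_def strongly_connected_def)
  \<comment> \<open>Connectedness speaks of the symmetric closure, which is \<open>T\<close> itself
    here.\<close>
  then have "v \<rightarrow>\<^sup>*\<^bsub>T\<^esub> w" using reachable_mk_symmetric_eq sym_arcs by simp
  then have "(v, w) \<in> (parcs T)\<^sup>*" by (simp add: reachable_conv)
  then show ?thesis using w by (metis converse_rtranclE)
qed

text \<open>An edge outside the subgraph would close a cycle with a path inside it.\<close>
lemma is_tree_spanning_subgraph:
  assumes "is_tree T" "E \<subseteq> parcs T" "\<And>u v. u \<in> pverts T \<Longrightarrow> v \<in> pverts T \<Longrightarrow> (u, v) \<in> E\<^sup>*"
  shows "parcs T = E"
proof (rule ccontr)
  assume "parcs T \<noteq> E"
  then obtain u w where uw: "(u, w) \<in> parcs T" "(u, w) \<notin> E" using assms(2) by auto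
  interpret pair_graph T using assms by (simp add: is_tree_def)
  let ?H = "\<lparr>pverts = pverts T, parcs = E\<rparr>"
  interpret H: pair_wf_digraph ?H
    using assms(2) wellformed' by unfold_locales auto
  have verts: "u \<in> pverts T" "w \<in> pverts T" using uw wellformed' by auto
  then have "u \<rightarrow>\<^sup>*\<^bsub>?H\<^esub> w" using assms(3) by (simp add: H.reachable_conv)
  then obtain q where q: "H.apath u q w" using H.reachable_apath by blast
  have wu: "(w, u) \<in> parcs T" "u \<noteq> w" using uw arcs_symmetric no_loops' by auto
  have qE: "set q \<subseteq> E" "pcas u q w" "distinct (pawalk_verts u q)"
    using q by (auto simp: H.apath_def H.awalk_def)
  \<comment> \<open>The path has at least two arcs because \<open>u \<noteq> w\<close> and the arc
    itself is not in \<open>E\<close>. Thus the closed walk is a genuine cycle and not an edge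
    traversed back and forth.\<close>
  have "length q \<noteq> 0" "length q \<noteq> 1"
    using qE uw(2) wu(2) by (auto simp: length_Suc_conv)
  then have "3 \<le> length ((w, u) # q)" unfolding list.size by linarith
  moreover have "cycle ((w, u) # q)"
    using qE wu verts assms(2) by (auto simp: cycle_def awalk_def intro!: exI[of _ w])
  ultimately show False using assms(1) unfolding is_tree_def by blast
qed

section \<open>Total and semitotal domination\<close>

lemma total_domination_number_le:
  "total_dominating G X \<Longrightarrow> total_domination_number G \<le> card X"
  unfolding total_domination_number_def by (rule Least_le) blast

lemma semitotal_domination_number_le:
  "semitotal_dominating G X \<Longrightarrow> semitotal_domination_number G \<le> card X"
  unfolding semitotal_domination_number_def by (rule Least_le) blast

text \<open>Without isolated vertices the full vertex set is admissible, so \<open>LEAST\<close>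
  ranges over a nonempty set.\<close>

lemma total_dominating_attains:
  assumes "pair_graph G" "\<And>v. v \<in> pverts G \<Longrightarrow> \<exists>u. (v, u) \<in> parcs G"
  obtains X where "total_dominating G X" "card X = total_domination_number G"
proof -
  interpret pair_graph G by fact
  have "total_dominating G (pverts G)"
    using assms(2) wellformed' unfolding total_dominating_def by blast
  then have "\<exists>k X. total_dominating G X \<and> card X = k" by blast
  from LeastI_ex[OF this] show ?thesis
    using that unfolding total_domination_number_def by blast
qed

lemma semitotal_dominating_attains:
  assumes "pair_graph G" "\<And>v. v \<in> pverts G \<Longrightarrow> \<exists>u. (v, u) \<in> parcs G"
  obtains X where "semitotal_dominating G X" "card X = semitotal_domination_number G"
proof -
  interpret pair_graph G by fact
  have "\<exists>w\<in>pverts G. w \<noteq> v \<and> distance G v w \<le> 2" if "v \<in> pverts G" for v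
    using assms(2)[OF that] distance_le_2_iff[OF pair_wf_digraph that] wellformed' no_loops' by metis
  then have "semitotal_dominating G (pverts G)"
    unfolding semitotal_dominating_def dominating_def by blast
  then have "\<exists>k X. semitotal_dominating G X \<and> card X = k" by blast
  from LeastI_ex[OF this] show ?thesis
    using that unfolding semitotal_domination_number_def by blast
qed

text \<open>The members of \<open>X\<close> outside \<open>P\<close> each receive a neighbour of their own.\<close>
lemma total_domination_number_le_add:
  assumes "pair_graph G" "\<And>v. v \<in> pverts G \<Longrightarrow> \<exists>u. (v, u) \<in> parcs G"
    and X: "dominating G X" and "P \<subseteq> X" "Z \<subseteq> pverts G"
    and P: "\<And>x. x \<in> P \<Longrightarrow> \<exists>u\<in>X \<union> Z. (x, u) \<in> parcs G"
  shows "total_domination_number G + card P \<le> 2 * card X + card Z"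
proof -
  interpret pair_graph G by fact
  have XV: "X \<subseteq> pverts G" using X by (simp add: dominating_def)
  have fin: "finite X" "finite Z" "finite P"
    using XV assms(4,5) pair_finite_verts by (meson finite_subset)+
  obtain n where n: "\<And>v. v \<in> pverts G \<Longrightarrow> (v, n v) \<in> parcs G" using assms(2) by metis
  \<comment> \<open>Members of \<open>P\<close> are served by \<open>X \<union> Z\<close>; vertices
    outside \<open>X\<close> are served by \<open>X\<close>.\<close>
  let ?Y = "X \<union> Z \<union> n ` (X - P)"
  have "total_dominating G ?Y"
    unfolding total_dominating_def
  proof (intro conjI ballI)
    show "?Y \<subseteq> pverts G" using XV assms(5) in_arcsD2[OF n] by auto
  next
    fix v assume v: "v \<in> pverts G"
    show "\<exists>u\<in>?Y. (v, u) \<in> parcs G"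
    proof (cases "v \<in> X")
      case True
      then show ?thesis using P[of v] n[OF v] by (cases "v \<in> P") auto
    next
      case False
      then show ?thesis using X v unfolding dominating_def by blast
    qed
  qed
  then have "total_domination_number G \<le> card ?Y" by (rule total_domination_number_le)
  also have "\<dots> \<le> card X + card Z + card (n ` (X - P))"
    using card_Un_le[of X Z] card_Un_le[of "X \<union> Z" "n ` (X - P)"] by linarith
  also have "card (n ` (X - P)) \<le> card (X - P)" using fin by (intro card_image_le) auto
  also have "card (X - P) = card X - card P" using fin assms(4) by (intro card_Diff_subset) auto
  \<comment> \<open>\<open>card P \<le> card X\<close> keeps the natural-number subtraction from
    truncating.\<close>
  finally show ?thesis using card_mono[OF fin(1) assms(4)] by linarith
qed

section \<open>Domination in spiders\<close>

text \<open>Bounds the semitotal domination number by \<open>card B + 1\<close>; the common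
  neighbour \<open>d b\<close> puts \<open>a\<close> and \<open>b\<close> at distance at most
  2.\<close>

lemma semitotal_dominating_spider:
  assumes sp: "spider a B d L p" and G: "G = spider_graph a B d L p" and wf: "pair_wf_digraph G"
  shows "semitotal_dominating G (insert a B)"
proof -
  have "dominating G (insert a B)"
    unfolding dominating_def
  proof (intro conjI ballI)
    show "insert a B \<subseteq> pverts G" by (auto simp: G spider_graph_def)
  next
    fix v assume "v \<in> pverts G - insert a B"
    then consider "v \<in> d ` B" | "v \<in> L" by (auto simp: G spider_graph_def)
    then show "\<exists>u\<in>insert a B. (v, u) \<in> parcs G"
    proof cases
      case 1
      then show ?thesis by (simp add: G parcs_spider_graph_iff)
    next
      case 2
      then have "p v \<in> insert a B" "(v, p v) \<in> parcs G"
        using sp by (auto simp: G parcs_spider_graph_iff spider_def)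
      then show ?thesis by blast
    qed
  qed
  moreover have near: "distance G a b \<le> 2" "distance G b a \<le> 2" "b \<noteq> a" if b: "b \<in> B" for b
  proof -
    have arcs: "(a, d b) \<in> parcs G" "(d b, b) \<in> parcs G" "(b, d b) \<in> parcs G" "(d b, a) \<in> parcs G"
      and verts: "a \<in> pverts G" "b \<in> pverts G"
      using b by (simp_all add: G parcs_spider_graph_iff) (simp_all add: spider_graph_def)
    show "b \<noteq> a" using b sp by (auto simp: spider_def)
    then show "distance G a b \<le> 2" "distance G b a \<le> 2"
      using arcs distance_le_2_iff[OF wf verts(1), of b] distance_le_2_iff[OF wf verts(2), of a]
      by auto
  qed
  moreover obtain b where "b \<in> B" using sp by (auto simp: spider_def)
  ultimately show ?thesis
    unfolding semitotal_dominating_def by (metis insert_iff)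
qed

text \<open>The leaves force all of \<open>insert a B\<close> into \<open>X\<close>, and the neighbourhoods of the members of \<open>B\<close> are
  disjoint from \<open>insert a B\<close> and from each other.\<close>
lemma card_total_dominating_spider:
  assumes sp: "spider a B d L p" and G: "G = spider_graph a B d L p" and X: "total_dominating G X"
  shows "2 * card B + 1 \<le> card X"
proof -
  have finX: "finite X"
    using X sp unfolding total_dominating_def G spider_def
    by (auto simp: spider_graph_def elim!: finite_subset)
  have "insert a B \<subseteq> X"
  proof
    fix x assume "x \<in> insert a B"
    then obtain l where l: "l \<in> L" "p l = x" using sp unfolding spider_def by (metis imageE)
    then have "l \<in> pverts G" by (simp add: G spider_graph_def)
    then obtain u where u: "u \<in> X" "(l, u) \<in> parcs G" using X by (auto simp: total_dominating_def)
    have "l \<notin> insert a B \<union> d ` B" "p ` L \<inter> L = {}" using sp l by (auto simp: spider_def)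
    then have "u = x" using u(2) l unfolding G parcs_spider_graph_iff by auto
    then show "x \<in> X" using u by simp
  qed
  have "\<forall>b\<in>B. \<exists>u\<in>X. (b, u) \<in> parcs G"
    using X by (auto simp: total_dominating_def G spider_graph_def)
  then obtain n where n: "\<And>b. b \<in> B \<Longrightarrow> n b \<in> X" "\<And>b. b \<in> B \<Longrightarrow> (b, n b) \<in> parcs G" by metis
  have nb: "n b = d b \<or> n b \<in> L \<and> p (n b) = b" if "b \<in> B" for b
  proof -
    have "b \<noteq> a" "b \<notin> d ` B" "b \<notin> L" using that sp by (auto simp: spider_def)
    then show ?thesis using n(2)[OF that] unfolding G parcs_spider_graph_iff by auto
  qed
  \<comment> \<open>Values of \<open>d\<close> are distinct, leaves are told apart by
    \<open>p\<close>, and no value of \<open>d\<close> is a leaf.\<close>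
  have "inj_on n B"
  proof (rule inj_onI)
    fix b b' assume b: "b \<in> B" "b' \<in> B" "n b = n b'"
    have "d b \<notin> L" "d b' \<notin> L" "d b = d b' \<Longrightarrow> b = b'"
      using b sp by (auto simp: spider_def dest: inj_onD)
    then show "b = b'" using nb[OF b(1)] nb[OF b(2)] unfolding b(3) by metis
  qed
  then have "card (n ` B) = card B" by (rule card_image)
  moreover have "n b \<notin> insert a B" if "b \<in> B" for b
  proof -
    have "d b \<notin> insert a B" "L \<inter> insert a B = {}" using sp that by (auto simp: spider_def)
    then show ?thesis using nb[OF that] by auto
  qed
  then have "insert a B \<inter> n ` B = {}" by blast
  moreover have "finite B" "a \<notin> B" using sp by (auto simp: spider_def)
  ultimately have "card (insert a B \<union> n ` B) = 2 * card B + 1"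
    by (subst card_Un_disjoint) auto
  moreover have "insert a B \<union> n ` B \<subseteq> X" using n \<open>insert a B \<subseteq> X\<close> by auto
  ultimately show ?thesis using card_mono[OF finX] by metis
qed

section \<open>Extremal trees\<close>

text \<open>A graph without isolated vertices and without two disjoint edges is a star or a
  triangle, and either has a vertex adjacent to all others.\<close>

lemma ex_star_center:
  assumes sym: "\<And>x y. R x y \<Longrightarrow> R y x"
    and nbr: "\<And>x. x \<in> X \<Longrightarrow> \<exists>y\<in>X. y \<noteq> x \<and> R x y"
    and no_matching: "\<And>x y x' y'. {x, y, x', y'} \<subseteq> X \<Longrightarrow> distinct [x, y, x', y'] \<Longrightarrow> R x y \<Longrightarrow> \<not> R x' y'"
    and "X \<noteq> {}"
  shows "\<exists>a\<in>X. \<forall>b\<in>X - {a}. R a b"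
proof -
  obtain x y where xy: "x \<in> X" "y \<in> X" "x \<noteq> y" "R x y" using nbr \<open>X \<noteq> {}\<close> by (metis all_not_in_conv)
  have other: "R x w \<or> R y w" if w: "w \<in> X" "w \<noteq> x" "w \<noteq> y" for w
  proof -
    obtain v where "v \<in> X" "v \<noteq> w" "R w v" using nbr w by blast
    then show ?thesis using no_matching[of x y w v] xy w sym by auto
  qed
  show ?thesis
  proof (rule ccontr)
    assume "\<not> ?thesis"
    \<comment> \<open>If neither end of the edge \<open>x y\<close> is a centre, then
      \<open>y w\<close> and \<open>x w'\<close> turn out to be disjoint edges: \<open>w\<close> and
      \<open>w'\<close> differ because only the latter is related to \<open>x\<close>.\<close>
    then obtain w w' where w: "w \<in> X" "w \<noteq> x" "\<not> R x w" and w': "w' \<in> X" "w' \<noteq> y" "\<not> R y w'"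
      using xy by blast
    then have "w \<noteq> y" "w' \<noteq> x" using xy sym by blast+
    then have "R y w" "R x w'" using other w w' by blast+
    then show False
      using no_matching[of y w x w'] xy w w' \<open>w \<noteq> y\<close> \<open>w' \<noteq> x\<close> by auto
  qed
qed

text \<open>Each property of the spider is forced by \<open>extremal\<close>, which excludes total
  dominating sets with fewer than \<open>2 * card X - 1\<close> members.\<close>

lemma extremal_tree_is_spider:
  assumes tree: "is_tree T" and nontriv: "2 \<le> card (pverts T)"
    and X: "semitotal_dominating T X" and extremal: "2 * card X \<le> total_domination_number T + 1"
  shows "\<exists>a B d L p. spider a B d L p \<and> T = spider_graph a B d L p"
proof -
  interpret pair_graph T using tree by (simp add: is_tree_def)
  have dom: "dominating T X" and XV: "X \<subseteq> pverts T"
    using X by (auto simp: semitotal_dominating_def dominating_def)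
  have finX: "finite X" using XV pair_finite_verts by (rule finite_subset)
  \<comment> \<open>Serving \<open>P\<close> with the help of \<open>Z\<close> saves
    \<open>card P - card Z\<close> vertices against \<open>2 * card X\<close>, and at most 1 may be
    saved. Below, a saving of 2 is refuted for two adjacent members, two disjoint pairs with common
    neighbours, and three members with one common neighbour.\<close>
  have few: "card P \<le> card Z + 1"
    if "P \<subseteq> X" "Z \<subseteq> pverts T" "\<And>x. x \<in> P \<Longrightarrow> \<exists>u\<in>X \<union> Z. (x, u) \<in> parcs T" for P Z
    using total_domination_number_le_add[OF pair_graph is_tree_no_isolated[OF tree nontriv] dom that]
      extremal by linarith
  have indep: "(x, y) \<notin> parcs T" if "x \<in> X" "y \<in> X" for x y
  proof
    assume xy: "(x, y) \<in> parcs T"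
    then have "x \<noteq> y" "(y, x) \<in> parcs T" using no_loops' arcs_symmetric by auto
    then show False using few[of "{x, y}" "{}"] that xy by auto
  qed
  define R where "R x y \<longleftrightarrow> (\<exists>z. (x, z) \<in> parcs T \<and> (z, y) \<in> parcs T)" for x y
  have "\<exists>a\<in>X. \<forall>b\<in>X - {a}. R a b"
  proof (rule ex_star_center)
    show "R y x" if "R x y" for x y using that arcs_symmetric unfolding R_def by blast
    show "\<exists>y\<in>X. y \<noteq> x \<and> R x y" if "x \<in> X" for x
    proof -
      from X that obtain y where "y \<in> X" "y \<noteq> x" "distance T x y \<le> 2"
        by (metis semitotal_dominating_def)
      moreover from this have "(x, y) \<in> parcs T \<or> R x y"
        using that XV distance_le_2_iff[OF pair_wf_digraph, of x y] by (auto simp: R_def)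
      ultimately show ?thesis using that indep by blast
    qed
    show "\<not> R x' y'" if xs: "{x, y, x', y'} \<subseteq> X" "distinct [x, y, x', y']" "R x y" for x y x' y'
    proof
      assume "R x' y'"
      then obtain z z' where z: "(x, z) \<in> parcs T" "(y, z) \<in> parcs T" "(x', z') \<in> parcs T" "(y', z') \<in> parcs T"
        using xs(3) arcs_symmetric unfolding R_def by metis
      then have "card {x, y, x', y'} \<le> card {z, z'} + 1"
        using xs(1) in_arcsD2 by (intro few) auto
      moreover have "card {z, z'} \<le> 2" by (simp add: card_insert_if)
      ultimately show False using xs(2) by simp
    qed
    show "X \<noteq> {}" using dom nontriv by (auto simp: dominating_def)
  qed
  then obtain a where a: "a \<in> X" "\<And>b. b \<in> X - {a} \<Longrightarrow> R a b" by blast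
  define B where "B = X - {a}"
  have XB: "X = insert a B" and aB: "a \<notin> B" and finB: "finite B" using a finX by (auto simp: B_def)
  have "\<forall>b\<in>B. \<exists>z. (b, z) \<in> parcs T \<and> (z, a) \<in> parcs T"
    using a(2) arcs_symmetric unfolding B_def R_def by metis
  then obtain d where d: "\<And>b. b \<in> B \<Longrightarrow> (b, d b) \<in> parcs T" "\<And>b. b \<in> B \<Longrightarrow> (d b, a) \<in> parcs T" by metis
  have inj: "inj_on d B"
  proof (rule inj_onI, rule ccontr)
    fix b b' assume b: "b \<in> B" "b' \<in> B" "d b = d b'" "b \<noteq> b'"
    then have "card {a, b, b'} \<le> card {d b} + 1"
      using d XB in_arcsD2 arcs_symmetric by (intro few) fastforce+
    moreover have "a \<noteq> b" "a \<noteq> b'" using b aB by auto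
    ultimately show False using b(4) by simp
  qed
  have dX: "d b \<notin> X" if "b \<in> B" for b using indep[of b "d b"] d that XB by auto
  define L where "L = pverts T - X - d ` B"
  have "\<forall>l\<in>L. \<exists>x\<in>X. (l, x) \<in> parcs T" using dom by (auto simp: L_def dominating_def)
  then obtain p where p: "\<And>l. l \<in> L \<Longrightarrow> p l \<in> X" "\<And>l. l \<in> L \<Longrightarrow> (l, p l) \<in> parcs T" by metis
  let ?G = "spider_graph a B d L p"
  have verts: "pverts T = pverts ?G"
    using XV d in_arcsD2 XB unfolding spider_graph_def by (auto simp: L_def)
  have "parcs T = parcs ?G"
  \<comment> \<open>Every vertex reaches \<open>a\<close> along the chosen arcs, and these are
    symmetric, so they connect any two vertices.\<close>
  proof (rule is_tree_spanning_subgraph[OF tree])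
    show "parcs ?G \<subseteq> parcs T"
      using d p arcs_symmetric by (auto simp: spider_graph_def edges_def)
  next
    have "sym (parcs ?G)" by (auto simp: spider_graph_def edges_def sym_def)
    then have sym: "sym ((parcs ?G)\<^sup>*)" by (rule sym_rtrancl)
    have B: "(b, a) \<in> (parcs ?G)\<^sup>*" if "b \<in> B" for b
      using that by (intro rtrancl_trans[OF r_into_rtrancl[of "(b, d b)"] r_into_rtrancl])
        (auto simp: parcs_spider_graph_iff)
    have to_a: "(v, a) \<in> (parcs ?G)\<^sup>*" if v: "v \<in> pverts ?G" for v
    proof -
      consider "v = a" | "v \<in> B" | "v \<in> d ` B" | "v \<in> L"
        using v by (auto simp: spider_graph_def)
      then show ?thesis
      proof cases
        case 4
        then have "(v, p v) \<in> parcs ?G" by (simp add: parcs_spider_graph_iff)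
        moreover have "(p v, a) \<in> (parcs ?G)\<^sup>*" using p(1)[OF 4] XB B by auto
        ultimately show ?thesis by (rule converse_rtrancl_into_rtrancl)
      qed (use B in \<open>auto simp: parcs_spider_graph_iff intro!: r_into_rtrancl\<close>)
    qed
    show "(u, v) \<in> (parcs ?G)\<^sup>*" if "u \<in> pverts T" "v \<in> pverts T" for u v
      using to_a that verts symD[OF sym] by (metis rtrancl_trans)
  qed
  then have T: "T = ?G" using verts by simp
  have "B \<noteq> {}" using X a(1) XB unfolding semitotal_dominating_def by blast
  have "x \<in> p ` L" if x: "x \<in> X" for x
  proof (rule ccontr)
    assume nx: "x \<notin> p ` L"
    \<comment> \<open>\<open>?Y\<close> is totally dominating: \<open>a\<close> and \<open>B\<close>
      have neighbours \<open>d b\<close>, each \<open>d b\<close> keeps at least one of its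
      neighbours \<open>a\<close> and \<open>b\<close>, and no leaf hangs at \<open>x\<close>. Its
      size \<open>2 * card X - 2\<close> is one too small.\<close>
    let ?Y = "X \<union> d ` B - {x}"
    have "\<exists>u\<in>?Y. (v, u) \<in> parcs ?G" if v: "v \<in> pverts ?G" for v
    proof -
      have dY: "d b \<in> ?Y" if "b \<in> B" for b using dX[OF that] that x by auto
      consider "v = a" | "v \<in> B" | b where "b \<in> B" "v = d b" | "v \<in> L"
        using v by (auto simp: spider_graph_def)
      then show ?thesis
      proof cases
        case 1
        then show ?thesis using \<open>B \<noteq> {}\<close> dY by (auto simp: parcs_spider_graph_iff)
      next
        case 2
        then show ?thesis using dY by (auto simp: parcs_spider_graph_iff)
      next
        case 3
        then have "(v, a) \<in> parcs ?G" "(v, b) \<in> parcs ?G" "a \<noteq> b"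
          using aB by (auto simp: parcs_spider_graph_iff)
        then show ?thesis using XB 3 by blast
      next
        case 4
        then have "(v, p v) \<in> parcs ?G" "p v \<in> ?Y" using nx p(1) by (auto simp: parcs_spider_graph_iff)
        then show ?thesis by blast
      qed
    qed
    moreover have "?Y \<subseteq> pverts ?G" using XB by (auto simp: spider_graph_def)
    ultimately have "total_dominating T ?Y"
      unfolding total_dominating_def T by blast
    then have "total_domination_number T \<le> card ?Y" by (rule total_domination_number_le)
    moreover have "card (X \<union> d ` B) = card X + card B"
      using finX finB inj dX by (subst card_Un_disjoint) (auto simp: card_image)
    moreover have "card X = card B + 1" using XB aB finB by simp
    moreover have "card ?Y = card (X \<union> d ` B) - 1" using x by (intro card_Diff_singleton) auto
    ultimately show False using extremal by linarith
  qed
  then have "p ` L = insert a B" using p(1) XB by auto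
  moreover have "finite L" using pair_finite_verts by (simp add: L_def)
  moreover have "d ` B \<inter> insert a B = {}" using dX XB by auto
  moreover have "L \<inter> (insert a B \<union> d ` B) = {}" using XB by (auto simp: L_def)
  ultimately have "spider a B d L p"
    using finB \<open>B \<noteq> {}\<close> aB inj by (simp add: spider_def)
  then show ?thesis using T by blast
qed

section \<open>The bound and its equality case\<close>

theorem theorem3p2:
  fixes T :: "'a pair_pre_digraph"
  assumes "is_tree T" and "2 \<le> card (pverts T)"
  shows "int (total_domination_number T) \<le> 2 * int (semitotal_domination_number T) - 1 \<and>
    (int (total_domination_number T) = 2 * int (semitotal_domination_number T) - 1 \<longleftrightarrow>
      (\<exists>S'. labeling T S' \<and> (T, S') \<in> family_T1))"
proof -
  interpret pair_graph T using assms(1) by (simp add: is_tree_def)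
  note no_isolated = is_tree_no_isolated[OF assms]
  obtain X where X: "semitotal_dominating T X" "card X = semitotal_domination_number T"
    using semitotal_dominating_attains[OF pair_graph no_isolated] .
  have dom: "dominating T X" and XV: "X \<subseteq> pverts T"
    using X by (auto simp: semitotal_dominating_def dominating_def)
  have "X \<noteq> {}" using dom assms(2) by (auto simp: dominating_def)
  then obtain x y where xy: "x \<in> X" "y \<in> X" "y \<noteq> x" "distance T x y \<le> 2"
    using X unfolding semitotal_dominating_def by blast
  then have "(x, y) \<in> parcs T \<or> (\<exists>z. (x, z) \<in> parcs T \<and> (z, y) \<in> parcs T)"
    using distance_le_2_iff[OF pair_wf_digraph, of x y] XV by auto
  \<comment> \<open>A common neighbour if there is one; for adjacent \<open>x\<close> and
    \<open>y\<close>, the choice \<open>z = y\<close> works. Adding \<open>z\<close> serves both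
    vertices of the pair and so saves one.\<close>
  then obtain z where "z \<in> pverts T" "(x, z) \<in> parcs T" "(y, z) \<in> parcs T \<or> (y, x) \<in> parcs T"
    using arcs_symmetric in_arcsD2 by metis
  then have "total_domination_number T + card {x, y} \<le> 2 * card X + card {z}"
    using xy by (intro total_domination_number_le_add[OF pair_graph no_isolated dom]) auto
  then have le: "total_domination_number T + 1 \<le> 2 * semitotal_domination_number T"
    using xy X by simp
  \<comment> \<open>In a spider the two numbers are at most \<open>card B + 1\<close> (semitotal)
    and at least \<open>2 * card B + 1\<close> (total).\<close>
  have "2 * semitotal_domination_number T \<le> total_domination_number T + 1"
    if fam: "(T, S) \<in> family_T1" for S
  proof -
    obtain a B d L p where sp: "spider a B d L p" "T = spider_graph a B d L p"
      using family_T1_imp_spider[OF fam] by blast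
    obtain Y where "total_dominating T Y" "card Y = total_domination_number T"
      using total_dominating_attains[OF pair_graph no_isolated] .
    then have "2 * card B + 1 \<le> total_domination_number T"
      using card_total_dominating_spider[OF sp] by metis
    moreover have "semitotal_domination_number T \<le> card (insert a B)"
      using semitotal_dominating_spider[OF sp pair_wf_digraph] by (rule semitotal_domination_number_le)
    moreover have "card (insert a B) = card B + 1" using sp(1) by (simp add: spider_def)
    ultimately show ?thesis by linarith
  qed
  moreover have "\<exists>S. labeling T S \<and> (T, S) \<in> family_T1"
    if "2 * semitotal_domination_number T \<le> total_domination_number T + 1"
    using extremal_tree_is_spider[OF assms X(1)] X(2) that spider_imp_family_T1 by metis
  ultimately have "total_domination_number T + 1 = 2 * semitotal_domination_number T \<longleftrightarrow>
      (\<exists>S. labeling T S \<and> (T, S) \<in> family_T1)"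
    using le by (metis le_antisym order_refl)
  moreover have "int (total_domination_number T) = 2 * int (semitotal_domination_number T) - 1 \<longleftrightarrow>
      total_domination_number T + 1 = 2 * semitotal_domination_number T"
    by linarith
  ultimately show ?thesis using le by auto
qed

end
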